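(* Let $a_1<a_2<a_3$ be positive integers with $\gcd(a_1,a_2,a_3)=1$. Then $$g_0(a_1,a_2,a_3)<g_1(a_1,a_2,a_3).$$
   Context: For positive integers $a_1,\dots,a_n$ with $\gcd(a_1,\dots,a_n)=1$ and $k\ge0$, $g_k(a_1,\dots,a_n)$ denotes the largest positive integer $b$ such that $a_1x_1+\dots+a_nx_n=b$ has exactly $k$ nonnegative integral solutions, if such $b$ exists, and $g_k(a_1,\dots,a_n)=0$ otherwise. *)

theory Defs
  imports Main
begin

definition nonneg_solutions :: "nat list \<Rightarrow> nat \<Rightarrow> nat list set" where
  "nonneg_solutions as b =
     {xs. length xs = length as \<and> (\<Sum>i<length as. as ! i * xs ! i) = b}"

(* Finiteness is required explicitly because card is 0 on infinite sets;
   it is automatic when all coefficients are positive. *)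
definition has_exactly_solutions :: "nat list \<Rightarrow> nat \<Rightarrow> nat \<Rightarrow> bool" where
  "has_exactly_solutions as k b \<longleftrightarrow>
     finite (nonneg_solutions as b) \<and> card (nonneg_solutions as b) = k"

definition is_largest_with :: "nat list \<Rightarrow> nat \<Rightarrow> nat \<Rightarrow> bool" where
  "is_largest_with as k b \<longleftrightarrow>
     b > 0 \<and> has_exactly_solutions as k b \<and>
     (\<forall>c>0. has_exactly_solutions as k c \<longrightarrow> c \<le> b)"

definition frobenius_g :: "nat \<Rightarrow> nat list \<Rightarrow> nat" where
  "frobenius_g k as =
     (if \<exists>b. is_largest_with as k b then THE b. is_largest_with as k b else 0)"

end

theory Submission
  imports Defs
begin

text \<open>
  Let \<open>F\<close> be the largest number without a representation and suppose that no number above \<open>F\<close>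
  has exactly one. Every representation of \<open>F + a\<^sub>1\<close> has \<open>x\<^sub>1 = 0\<close>, and similarly for \<open>a\<^sub>2\<close>, \<open>a\<^sub>3\<close>;
  hence \<open>F + a\<^sub>k\<close> is divisible by \<open>gcd a\<^sub>i a\<^sub>j\<close>. Writing \<open>s = F + a\<^sub>1 + a\<^sub>2 + a\<^sub>3\<close>, reducing
  a Bezout representation modulo the lcm gives \<open>s \<le> lcm a\<^sub>1 a\<^sub>2 + gcd a\<^sub>1 a\<^sub>2 * a\<^sub>3\<close>, while
  two different representations of \<open>F + a\<^sub>1\<close> force
  \<open>s \<ge> lcm a\<^sub>2 a\<^sub>3 + gcd a\<^sub>1 a\<^sub>3 * a\<^sub>2 + gcd a\<^sub>1 a\<^sub>2 * a\<^sub>3\<close>. So \<open>lcm a\<^sub>2 a\<^sub>3 < lcm a\<^sub>1 a\<^sub>2\<close>,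
  and exchanging \<open>a\<^sub>1\<close> and \<open>a\<^sub>3\<close> gives the opposite inequality.
\<close>

section \<open>Representability, and bounds on a nonrepresentable number\<close>

definition representable :: "nat \<Rightarrow> nat \<Rightarrow> nat \<Rightarrow> nat \<Rightarrow> bool" where
  "representable a b c n \<longleftrightarrow> (\<exists>x y z. a * x + b * y + c * z = n)"

lemma representable_swap13: "representable a b c n \<longleftrightarrow> representable c b a n"
  unfolding representable_def by (metis add.commute add.left_commute)

lemma representable_swap12: "representable a b c n \<longleftrightarrow> representable b a c n"
  unfolding representable_def by (metis add.commute)

text \<open>If \<open>a\<close> were used at least once, removing one copy would represent
  \<open>F\<close>.\<close>

lemma coeff_zero_above_nonrepresentable:
  assumes "\<not> representable a b c F" "a * x + b * y + c * z = F + a"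
  shows "x = 0"
proof (cases x)
  case (Suc k)
  then have "a * k + b * y + c * z = F" using assms(2) by simp
  then show ?thesis using assms(1) unfolding representable_def by blast
qed

lemma gcd_dvd_above_nonrepresentable:
  assumes "\<not> representable a b c F" "representable a b c (F + a)"
  shows "gcd b c dvd F + a"
proof -
  obtain x y z where r: "a * x + b * y + c * z = F + a"
    using assms(2) unfolding representable_def by blast
  have "x = 0" using coeff_zero_above_nonrepresentable[OF assms(1) r] .
  then have "F + a = b * y + c * z" using r by simp
  then show ?thesis by simp
qed

lemma nonrepresentable_le:
  fixes a b c F :: nat
  assumes "0 < a" "0 < b" and nr: "\<not> representable a b c F"
    and dv: "gcd a b dvd F + c"
  shows "F + a + b + c \<le> lcm a b + gcd a b * c"
proof -
  define f where "f = gcd a b"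
  have f0: "f > 0" using assms(1) by (simp add: f_def)
  obtain A where A: "a = f * A" unfolding f_def by (metis dvdE gcd_dvd1)
  obtain B where B: "b = f * B" unfolding f_def by (metis dvdE gcd_dvd2)
  have B0: "B > 0" using B assms(2) by (cases B) auto
  have L: "lcm a b = a * B"
    using prod_gcd_lcm_nat[of a b] f0 unfolding f_def[symmetric] by (simp add: B)
  obtain k where k: "F + c = f * k" using dv unfolding f_def by (metis dvdE)
  obtain u v where uv: "u * int a + v * int b = int f"
    using bezout_int[of "int a" "int b"] by (auto simp: f_def)
  \<comment> \<open>With this choice \<open>f * t\<close> is \<open>F - (f - 1) * c\<close>, the
    amount left for \<open>a\<close> and \<open>b\<close> once \<open>c\<close> is used
    \<open>f - 1\<close> times. It may be negative, hence the integers.\<close>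
  define t where "t = int k - int c"
  \<comment> \<open>The Bezout coefficient of \<open>a\<close> is reduced modulo \<open>B\<close>.
    Since \<open>a * B = b * A\<close>, the multiples of \<open>B\<close> taken from it reappear in
    \<open>y\<close> as multiples of \<open>A\<close>.\<close>
  define x where "x = (u * t) mod int B"
  define y where "y = v * t + ((u * t) div int B) * int A"
  have ut: "u * t = int B * ((u * t) div int B) + x" by (simp add: x_def)
  have "int a * x + int b * y = int f * t"
  proof -
    have "int a * x + int b * y = int a * (u * t) + int b * (v * t)"
      unfolding y_def by (subst (2) ut) (simp add: A B algebra_simps)
    also have "\<dots> = (u * int a + v * int b) * t" by (simp add: algebra_simps)
    finally show ?thesis by (simp add: uv)
  qed
  moreover have "int f * t = int F + int c - int f * int c"
    using arg_cong[OF k, of int] by (simp add: t_def algebra_simps)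
  ultimately have eq: "int a * x + int b * y = int F + int c - int f * int c" by simp
  have x0: "0 \<le> x" "x \<le> int B - 1" using B0 pos_mod_bound[of "int B" "u * t"]
    by (simp_all add: x_def)
  \<comment> \<open>Otherwise \<open>x\<close>, \<open>y\<close> and \<open>f - 1\<close> would be
    nonnegative coefficients representing \<open>F\<close>.\<close>
  have "y < 0"
  proof (rule ccontr)
    assume "\<not> y < 0"
    then have "int (a * nat x + b * nat y + c * (f - 1)) = int a * x + int b * y + int c * int (f - 1)"
      using x0 by simp
    also have "int (f - 1) = int f - 1" using f0 by simp
    finally have "int (a * nat x + b * nat y + c * (f - 1)) = int F"
      using eq by (simp only: right_diff_distrib mult.commute)
    then show False using nr unfolding representable_def by (metis of_nat_eq_iff)
  qed
  have "int a * x \<le> int a * (int B - 1)" using x0 by (intro mult_left_mono) auto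
  moreover have "int b * y \<le> int b * (-1)" using \<open>y < 0\<close> by (intro mult_left_mono) auto
  ultimately have "int F + int c - int f * int c \<le> int a * int B - int a - int b"
    using eq by (simp add: algebra_simps)
  then have "int (F + a + b + c) \<le> int (lcm a b + f * c)" by (simp add: L)
  then show ?thesis unfolding f_def by linarith
qed

text \<open>Adding \<open>b\<close> turns the representation into
  \<open>F + a + b = b * (y + 1) + c * z\<close>. Here \<open>gcd a c\<close> divides the left side
  and \<open>c * z\<close>, and it is coprime to \<open>b\<close>.\<close>

lemma dvd_Suc_coeff:
  fixes a b c :: nat
  assumes "gcd a (gcd b c) = 1" "b * y + c * z = F + a" "gcd a c dvd F + b"
  shows "gcd a c dvd y + 1"
proof -
  have "gcd a c dvd (F + b) + a" using assms(3) by simp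
  also have "(F + b) + a = b * (y + 1) + c * z" using assms(2) by simp
  finally have "gcd a c dvd b * (y + 1)" by (simp add: dvd_add_left_iff)
  moreover have "coprime (gcd a c) b"
    using assms(1) by (simp add: coprime_iff_gcd_eq_1 ac_simps)
  ultimately show ?thesis using coprime_dvd_mult_right_iff by blast
qed

text \<open>The sum \<open>F + a + b + c\<close> splits as
  \<open>b * (y - y') + b * (y' + 1) + c * (z + 1)\<close>. The first term is a positive multiple of
  both \<open>b\<close> and \<open>c\<close>; the other two are bounded below by divisibility of
  \<open>y' + 1\<close> and \<open>z + 1\<close>.\<close>

lemma le_of_two_representations:
  fixes a b c F :: nat
  assumes "0 < b" "0 < c" and g: "gcd a (gcd b c) = 1"
    and eq: "b * y + c * z = F + a" "b * y' + c * z' = F + a" and less: "y' < y"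
    and dv: "gcd a c dvd F + b" "gcd a b dvd F + c"
  shows "lcm b c + gcd a c * b + gcd a b * c \<le> F + a + b + c"
proof -
  have y': "gcd a c \<le> y' + 1"
    using dvd_Suc_coeff[OF g eq(2) dv(1)] by (intro dvd_imp_le) auto
  have z: "gcd a b \<le> z + 1"
    using dvd_Suc_coeff[of a c b z y F] g eq(1) dv(2)
    by (intro dvd_imp_le) (auto simp: ac_simps)
  have "b * y' + b * (y - y') = b * y"
    using less by (simp flip: distrib_left)
  then have bc: "c * z' = b * (y - y') + c * z" using eq by linarith
  then have "c dvd b * (y - y') + c * z" by (metis dvd_triv_left)
  then have "c dvd b * (y - y')" by (simp add: dvd_add_left_iff)
  then have "lcm b c dvd b * (y - y')" by simp
  then have "lcm b c \<le> b * (y - y')" using less assms(1) by (intro dvd_imp_le) auto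
  moreover have "gcd a c * b \<le> (y' + 1) * b" using y' by (intro mult_right_mono) auto
  moreover have "gcd a b * c \<le> (z + 1) * c" using z by (intro mult_right_mono) auto
  ultimately have "lcm b c + gcd a c * b + gcd a b * c \<le> b * (y - y') + (y' + 1) * b + (z + 1) * c"
    by linarith
  also have "\<dots> = F + a + b + c"
    using eq(1) \<open>b * y' + b * (y - y') = b * y\<close> by (simp add: algebra_simps)
  finally show ?thesis .
qed

section \<open>Solution lists of length three as representations\<close>

lemma nonneg_solutions_3:
  "nonneg_solutions [a, b, c] n = {[x, y, z] | x y z. a * x + b * y + c * z = n}"
proof -
  have "(\<Sum>i<length [a, b, c]. [a, b, c] ! i * xs ! i) = n \<and> length xs = length [a, b, c]
    \<longleftrightarrow> (\<exists>x y z. xs = [x, y, z] \<and> a * x + b * y + c * z = n)" for xs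
    by (auto simp: numeral_3_eq_3 length_Suc_conv lessThan_Suc)
  then show ?thesis unfolding nonneg_solutions_def by blast
qed

lemma finite_nonneg_solutions_3:
  assumes "0 < a" "0 < b" "0 < c"
  shows "finite (nonneg_solutions [a, b, c] n)"
proof (rule finite_subset)
  show "finite {xs. set xs \<subseteq> {..n} \<and> length xs = 3}"
    by (rule finite_lists_length_eq) simp
  have "x \<le> n \<and> y \<le> n \<and> z \<le> n" if "a * x + b * y + c * z = n" for x y z
  proof -
    have "x \<le> a * x" "y \<le> b * y" "z \<le> c * z" using assms by simp_all
    then show ?thesis using that by linarith
  qed
  then show "nonneg_solutions [a, b, c] n \<subseteq> {xs. set xs \<subseteq> {..n} \<and> length xs = 3}"
    unfolding nonneg_solutions_3 by auto
qed

lemma has_exactly_0_solutions_iff: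
  assumes "0 < a" "0 < b" "0 < c"
  shows "has_exactly_solutions [a, b, c] 0 n \<longleftrightarrow> \<not> representable a b c n"
  using finite_nonneg_solutions_3[OF assms, of n]
  unfolding has_exactly_solutions_def nonneg_solutions_3 representable_def by auto

lemma has_exactly_1_solutions_iff:
  assumes "0 < a" "0 < b" "0 < c"
  shows "has_exactly_solutions [a, b, c] 1 n \<longleftrightarrow>
    (\<exists>!(x, y, z). a * x + b * y + c * z = n)"
proof -
  define T where "T = {(x, y, z). a * x + b * y + c * z = n}"
  have img: "nonneg_solutions [a, b, c] n = (\<lambda>(x, y, z). [x, y, z]) ` T"
    unfolding nonneg_solutions_3 T_def by (force simp: image_def)
  \<comment> \<open>Counting lists thus becomes counting triples, for which cardinality one is
    unique existence.\<close>
  have "inj_on (\<lambda>(x, y, z). [x, y, z]) T" by (auto simp: inj_on_def)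
  then have "card (nonneg_solutions [a, b, c] n) = card T"
    unfolding img by (rule card_image)
  then have "has_exactly_solutions [a, b, c] 1 n \<longleftrightarrow> (\<exists>t. T = {t})"
    using finite_nonneg_solutions_3[OF assms] card_1_singleton_iff[of T]
    unfolding has_exactly_solutions_def by simp
  also have "\<dots> \<longleftrightarrow> (\<exists>!t. t \<in> T)" by blast
  finally show ?thesis unfolding T_def mem_Collect_eq .
qed

section \<open>Bounds for large numbers and existence of the maxima\<close>

lemma representable_if_large:
  fixes a b c n :: nat
  assumes "0 < a" and g: "gcd a (gcd b c) = 1" and n: "a * (b + c) \<le> n"
  shows "representable a b c n"
proof -
  obtain p q where "p * int b + q * int c = int (gcd b c)"
    using bezout_int[of "int b" "int c"] by auto
  moreover obtain u v where "u * int a + v * int (gcd b c) = 1"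
    using bezout_int[of "int a" "int (gcd b c)"] g by (auto simp: gcd_int_int_eq)
  ultimately have one: "u * int a + v * (p * int b + q * int c) = 1" by simp
  define Y where "Y = int n * v * p"
  define Z where "Z = int n * v * q"
  \<comment> \<open>The coefficients of \<open>b\<close> and \<open>c\<close> are reduced modulo
    \<open>a\<close>, and \<open>x\<close> absorbs the difference. The reduced terms cost at most
    \<open>a * (b + c) \<le> n\<close>, which keeps \<open>x\<close> nonnegative.\<close>
  define y where "y = Y mod int a"
  define z where "z = Z mod int a"
  define x where "x = int n * u + (Y div int a) * int b + (Z div int a) * int c"
  have Y: "Y = int a * (Y div int a) + y" and Z: "Z = int a * (Z div int a) + z"
    by (simp_all add: y_def z_def)
  have "int n = int n * (u * int a + v * (p * int b + q * int c))" by (simp add: one)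
  also have "\<dots> = int n * u * int a + Y * int b + Z * int c"
    by (simp add: Y_def Z_def algebra_simps)
  also have "\<dots> = int a * x + int b * y + int c * z"
    unfolding x_def by (subst Y, subst Z) (simp add: algebra_simps)
  finally have eq: "int a * x + int b * y + int c * z = int n" by simp
  have y: "0 \<le> y" "y \<le> int a" and z: "0 \<le> z" "z \<le> int a"
    using assms(1) by (simp_all add: y_def z_def order.strict_implies_order)
  have "int b * y + int c * z \<le> int b * int a + int c * int a"
    using y z by (intro add_mono mult_left_mono) auto
  also have "\<dots> = int (a * (b + c))" by (simp add: algebra_simps)
  also have "\<dots> \<le> int n" using n by (simp only: of_nat_le_iff)
  finally have "0 \<le> int a * x" using eq by linarith
  then have "0 \<le> x" using assms(1) by (simp add: zero_le_mult_iff)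
  then have "int (a * nat x + b * nat y + c * nat z) = int n"
    using eq y z by simp
  then show ?thesis unfolding representable_def by (metis of_nat_eq_iff)
qed

lemma not_has_exactly_1_solutions_if_large:
  fixes a b c n :: nat
  assumes pos: "0 < a" "0 < b" "0 < c" and g: "gcd a (gcd b c) = 1"
    and n: "a * (b + c) + a * b \<le> n"
  shows "\<not> has_exactly_solutions [a, b, c] 1 n"
proof
  assume "has_exactly_solutions [a, b, c] 1 n"
  then have uniq: "\<And>s t. (case s of (x, y, z) \<Rightarrow> a * x + b * y + c * z = n) \<Longrightarrow>
      (case t of (x, y, z) \<Rightarrow> a * x + b * y + c * z = n) \<Longrightarrow> s = t"
    unfolding has_exactly_1_solutions_iff[OF pos] by blast
  have "representable a b c (n - a * b)"
    using representable_if_large[OF pos(1) g] n by simp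
  then obtain x y z where "a * x + b * y + c * z = n - a * b"
    unfolding representable_def by blast
  then have r: "a * x + b * y + c * z + a * b = n" using n by simp
  \<comment> \<open>The reserved amount \<open>a * b\<close> can be spent as \<open>b\<close> copies
    of \<open>a\<close> or as \<open>a\<close> copies of \<open>b\<close>.\<close>
  have "(x + b, y, z) = (x, y + a, z)"
    by (rule uniq) (use r in \<open>simp_all add: algebra_simps\<close>)
  then show False using pos(2) by simp
qed

text \<open>A nonempty bounded set of positive numbers has a unique maximum, so
  \<open>frobenius_g\<close> takes that value instead of its default 0.\<close>

lemma is_largest_with_frobenius_g:
  assumes "0 < b" "has_exactly_solutions as k b"
    and "\<And>c. has_exactly_solutions as k c \<Longrightarrow> c \<le> N"
  shows "is_largest_with as k (frobenius_g k as)"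
proof -
  define m where "m = Greatest (\<lambda>c. 0 < c \<and> has_exactly_solutions as k c)"
  have P: "0 < m \<and> has_exactly_solutions as k m"
    unfolding m_def by (rule GreatestI_nat[of _ b N]) (use assms in auto)
  have le: "c \<le> m" if "0 < c" "has_exactly_solutions as k c" for c
    unfolding m_def by (rule Greatest_le_nat[of _ c N]) (use assms that in auto)
  have m: "is_largest_with as k m" unfolding is_largest_with_def using P le by blast
  have "frobenius_g k as = (THE b. is_largest_with as k b)"
    unfolding frobenius_g_def using m by auto
  also have "\<dots> = m"
    by (rule the_equality[of _ m]) (use m in \<open>auto simp: is_largest_with_def intro: order.antisym\<close>)
  finally show ?thesis using m by simp
qed

section \<open>Unique representations above the largest nonrepresentable number\<close>

lemma two_representations:
  assumes pos: "0 < a" "0 < b" "0 < c"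
    and "representable a b c n" "\<not> has_exactly_solutions [a, b, c] 1 n"
  obtains x y z x' y' z' where "a * x + b * y + c * z = n" "a * x' + b * y' + c * z' = n"
    "(x', y', z') \<noteq> (x, y, z)"
proof -
  obtain x y z where r: "a * x + b * y + c * z = n"
    using assms(4) unfolding representable_def by blast
  have "\<exists>t. (case t of (x', y', z') \<Rightarrow> a * x' + b * y' + c * z' = n) \<and> t \<noteq> (x, y, z)"
  proof (rule ccontr)
    assume "\<not> ?thesis"
    then have "\<exists>!(x, y, z). a * x + b * y + c * z = n"
      using r by (intro ex1I[of _ "(x, y, z)"]) blast+
    then show False using assms(5) has_exactly_1_solutions_iff[OF pos] by blast
  qed
  then obtain t where t: "case t of (x', y', z') \<Rightarrow> a * x' + b * y' + c * z' = n" "t \<noteq> (x, y, z)"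
    by blast
  obtain x' y' z' where t': "t = (x', y', z')" by (cases t)
  show thesis by (rule that[OF r, of x' y' z']) (use t in \<open>simp_all add: t'\<close>)
qed

text \<open>The lower and upper bounds on \<open>F + a + b + c\<close> share the term
  \<open>gcd a b * c\<close>. Cancelling it leaves the positive surplus \<open>gcd a c * b\<close>,
  which makes the inequality strict.\<close>

lemma lcm_less_lcm_if_two_representations:
  fixes a b c F :: nat
  assumes pos: "0 < a" "0 < b" "0 < c" and g: "gcd a (gcd b c) = 1"
    and nr: "\<not> representable a b c F"
    and rep: "representable a b c (F + b)" "representable a b c (F + c)"
    and r: "a * x + b * y + c * z = F + a" "a * x' + b * y' + c * z' = F + a"
    and ne: "(x', y', z') \<noteq> (x, y, z)"
  shows "lcm b c < lcm a b"
proof -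
  have d1: "gcd a c dvd F + b"
    using gcd_dvd_above_nonrepresentable[of b a c F] nr rep
    by (simp add: representable_swap12[of b a c])
  have d2: "gcd a b dvd F + c"
    using gcd_dvd_above_nonrepresentable[of c b a F] nr rep
    by (simp add: representable_swap13[of c b a] gcd.commute)
  have x: "x = 0" "x' = 0" using coeff_zero_above_nonrepresentable[OF nr] r by blast+
  then have e: "b * y + c * z = F + a" "b * y' + c * z' = F + a" using r by simp_all
  have "y \<noteq> y'"
  proof
    assume "y = y'"
    then have "c * z = c * z'" using e by (metis add_left_cancel)
    then show False using \<open>y = y'\<close> x ne pos(3) by simp
  qed
  \<comment> \<open>The two representations play symmetric roles, so either order of
    \<open>y\<close> and \<open>y'\<close> is covered.\<close>
  then have "lcm b c + gcd a c * b + gcd a b * c \<le> F + a + b + c"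
    using le_of_two_representations[OF pos(2,3) g e _ d1 d2]
      le_of_two_representations[OF pos(2,3) g e(2,1) _ d1 d2] by linarith
  moreover have "F + a + b + c \<le> lcm a b + gcd a b * c"
    by (rule nonrepresentable_le[OF pos(1,2) nr d2])
  moreover have "0 < gcd a c * b" using pos by simp
  ultimately show ?thesis by linarith
qed

lemma exists_unique_above_largest_nonrepresentable:
  fixes a b c F :: nat
  assumes pos: "0 < a" "0 < b" "0 < c" and g: "gcd a (gcd b c) = 1"
    and nr: "\<not> representable a b c F"
    and rep: "\<And>n. F < n \<Longrightarrow> representable a b c n"
  shows "\<exists>n>F. has_exactly_solutions [a, b, c] 1 n"
proof (rule ccontr)
  assume nu: "\<not> ?thesis"
  have rep': "representable a b c (F + t)" "\<not> has_exactly_solutions [a, b, c] 1 (F + t)"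
    if "0 < t" for t using rep nu that by simp_all
  obtain x y z x' y' z' where "a * x + b * y + c * z = F + a"
    "a * x' + b * y' + c * z' = F + a" "(x', y', z') \<noteq> (x, y, z)"
    by (rule two_representations[OF pos rep'[OF pos(1)]])
  then have "lcm b c < lcm a b"
    by (rule lcm_less_lcm_if_two_representations[OF pos g nr rep'(1)[OF pos(2)] rep'(1)[OF pos(3)]])
  moreover obtain x y z x' y' z' where "a * x + b * y + c * z = F + c"
    "a * x' + b * y' + c * z' = F + c" "(x', y', z') \<noteq> (x, y, z)"
    by (rule two_representations[OF pos rep'[OF pos(3)]])
  \<comment> \<open>The same argument with \<open>a\<close> and \<open>c\<close> exchanged reverses
    the inequality.\<close>
  then have "lcm b a < lcm c b"
    using lcm_less_lcm_if_two_representations[of c b a F z y x z' y' x'] pos g nr rep'(1)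
    by (auto simp: ac_simps representable_swap13[of c b a])
  ultimately show False by (simp add: lcm.commute)
qed

theorem theorem7:
  fixes a1 a2 a3 :: nat
  assumes "0 < a1" and "a1 < a2" and "a2 < a3"
    and "Gcd {a1, a2, a3} = 1"
  shows "frobenius_g 0 [a1, a2, a3] < frobenius_g 1 [a1, a2, a3]"
proof -
  have pos: "0 < a1" "0 < a2" "0 < a3" using assms by auto
  have g: "gcd a1 (gcd a2 a3) = 1" using assms(4) by simp
  have "\<exists>n>frobenius_g 0 [a1, a2, a3]. has_exactly_solutions [a1, a2, a3] 1 n"
  proof (cases "a1 = 1")
    case True
    \<comment> \<open>No number is missed here, so \<open>frobenius_g 0\<close> is the default 0.
      The witness \<open>a2 - 1\<close> is positive and too small to use \<open>a2\<close> or
      \<open>a3\<close>.\<close>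
    have "representable a1 a2 a3 n" for n
      unfolding representable_def by (rule exI[of _ n], rule exI[of _ 0], rule exI[of _ 0]) (simp add: True)
    then have "frobenius_g 0 [a1, a2, a3] = 0"
      unfolding frobenius_g_def is_largest_with_def has_exactly_0_solutions_iff[OF pos] by simp
    moreover have uniq: "x = a2 - 1 \<and> y = 0 \<and> z = 0"
      if "a1 * x + a2 * y + a3 * z = a2 - 1" for x y z
    proof -
      have "a2 * y < a2" "a3 * z < a3" using that assms by linarith+
      then show ?thesis using that True by simp
    qed
    moreover have "has_exactly_solutions [a1, a2, a3] 1 (a2 - 1)"
      unfolding has_exactly_1_solutions_iff[OF pos]
    proof (intro ex1I[of _ "(a2 - 1, 0, 0)"])
      fix t assume "case t of (x, y, z) \<Rightarrow> a1 * x + a2 * y + a3 * z = a2 - 1"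
      moreover obtain x y z where t: "t = (x, y, z)" by (cases t)
      ultimately have "a1 * x + a2 * y + a3 * z = a2 - 1" by simp
      from uniq[OF this] show "t = (a2 - 1, 0, 0)" by (simp add: t)
    qed (simp add: True)
    moreover have "0 < a2 - 1" using assms(2) True by linarith
    ultimately show ?thesis by metis
  next
    case False
    define F where "F = frobenius_g 0 [a1, a2, a3]"
    \<comment> \<open>All coefficients exceed 1, so 1 witnesses that a largest positive
      nonrepresentable number exists.\<close>
    have "\<not> representable a1 a2 a3 1"
      using assms(1-3) False unfolding representable_def by (auto simp: add_is_1)
    then have one: "has_exactly_solutions [a1, a2, a3] 0 1"
      unfolding has_exactly_0_solutions_iff[OF pos] .
    have "c \<le> a1 * (a2 + a3)" if "has_exactly_solutions [a1, a2, a3] 0 c" for c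
      using representable_if_large[OF pos(1) g] that
      unfolding has_exactly_0_solutions_iff[OF pos] by (meson nat_le_linear)
    with one have "is_largest_with [a1, a2, a3] 0 F"
      unfolding F_def by (intro is_largest_with_frobenius_g) simp_all
    then have F: "\<not> representable a1 a2 a3 F"
      "\<And>n. 0 < n \<Longrightarrow> \<not> representable a1 a2 a3 n \<Longrightarrow> n \<le> F"
      unfolding is_largest_with_def has_exactly_0_solutions_iff[OF pos] by blast+
    have "representable a1 a2 a3 n" if "F < n" for n
      using F(2)[of n] that by linarith
    with F(1) show ?thesis
      using exists_unique_above_largest_nonrepresentable[OF pos g] unfolding F_def by blast
  qed
  then obtain n where n: "frobenius_g 0 [a1, a2, a3] < n"
    "has_exactly_solutions [a1, a2, a3] 1 n" by blast
  have "is_largest_with [a1, a2, a3] 1 (frobenius_g 1 [a1, a2, a3])"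
  proof (rule is_largest_with_frobenius_g)
    show "0 < n" using n(1) by simp
    show "has_exactly_solutions [a1, a2, a3] 1 n" by (rule n(2))
    show "c \<le> a1 * (a2 + a3) + a1 * a2" if "has_exactly_solutions [a1, a2, a3] 1 c" for c
      using not_has_exactly_1_solutions_if_large[OF pos g] that by (meson nat_le_linear)
  qed
  then have "n \<le> frobenius_g 1 [a1, a2, a3]"
    using n unfolding is_largest_with_def by simp
  then show ?thesis using n(1) by simp
qed

end
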